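(* For all words $u,v\in\{0,1\}^*$ (finite, possibly empty words over $\{0,1\}$), the following identities hold in $\mathbb Z[a,b,q]$: $$[u10v]=q[u01v]+[u1v]+[u0v],\qquad [0v]=a[v],\qquad [u1]=b[u].$$
   Context: An alternative tree on a finite nonempty totally ordered set $S$ is an unordered rooted tree with vertex set $S$ such that (i) the root is $\min S$ or $\max S$; (ii) if a vertex is larger than its parent, it is larger than all of its descendants; (iii) if a vertex is smaller than its parent, it is smaller than all of its descendants. For $n\ge0$ let $\mathcal O_n$ be the set of alternative trees on $\{0,1,\ldots,n+1\}$ with root $0$. For $\mathcal T\in\mathcal O_n$ let $p(i)$ denote the parent of a non-root vertex $i$; $i$ is an excedance if $i<p(i)$; $\mathcal X(\mathcal T)\in\{0,1\}^n$ has $\mathcal X(\mathcal T)(i)=1$ iff $i\in\{1,\ldots,n\}$ is an excedance; $\mathrm{yy}(\mathcal T)$ is the number of pairs $1\le i<j\le n$ with $p(j)<i<j<p(i)$; $c_0(\mathcal T)$ is the number of children of $0$ and $c_1(\mathcal T)$ the number of children of $n+1$. For $a,b,q$ indeterminates and a word $\eta\in\{0,1\}^n$ (identified with an element of $\{0,1\}^n$), define $$[\eta]=\sum a^{c_0(\mathcal T)}b^{c_1(\mathcal T)}q^{\mathrm{yy}(\mathcal T)},$$ the sum over all $\mathcal T\in\bigcup_{n\ge0}\mathcal O_n$ with $\mathcal X(\mathcal T)=\eta$. *)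

theory Defs
  imports "HOL-Computational_Algebra.Polynomial"
begin

text \<open>
  An unordered rooted tree with vertex set \<open>S\<close> and root \<open>r\<close> is given by its parent map \<open>p\<close>:
  it is defined exactly on the non-root vertices, and following parents from any vertex
  eventually leads to the root (so there are no cycles and the tree is connected). Such maps
  correspond one-to-one to rooted labelled trees on \<open>S\<close>.
\<close>

definition parent_rel :: "('a \<rightharpoonup> 'a) \<Rightarrow> ('a \<times> 'a) set" where
  "parent_rel p = {(v, w). p v = Some w}"

definition rooted_tree :: "'a set \<Rightarrow> 'a \<Rightarrow> ('a \<rightharpoonup> 'a) \<Rightarrow> bool" where
  "rooted_tree S r p \<longleftrightarrow>
     r \<in> S \<and> dom p = S - {r} \<and> ran p \<subseteq> S \<and> (\<forall>v\<in>S. (v, r) \<in> (parent_rel p)\<^sup>*)"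

text \<open>Descendants are proper descendants: a vertex is not its own descendant.\<close>

definition descendants :: "('a \<rightharpoonup> 'a) \<Rightarrow> 'a \<Rightarrow> 'a set" where
  "descendants p v = {d. (d, v) \<in> (parent_rel p)\<^sup>+}"

definition children :: "('a \<rightharpoonup> 'a) \<Rightarrow> 'a \<Rightarrow> 'a set" where
  "children p v = {c. p c = Some v}"

definition alternative_tree :: "'a::linorder set \<Rightarrow> 'a \<Rightarrow> ('a \<rightharpoonup> 'a) \<Rightarrow> bool" where
  "alternative_tree S r p \<longleftrightarrow>
     finite S \<and> S \<noteq> {} \<and> rooted_tree S r p \<and>
     (r = Min S \<or> r = Max S) \<and>
     (\<forall>v w. p v = Some w \<longrightarrow> w < v \<longrightarrow> (\<forall>d\<in>descendants p v. d < v)) \<and>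
     (\<forall>v w. p v = Some w \<longrightarrow> v < w \<longrightarrow> (\<forall>d\<in>descendants p v. v < d))"

definition alt_trees :: "nat \<Rightarrow> (nat \<rightharpoonup> nat) set" where
  "alt_trees n = {p. alternative_tree {0..n+1} 0 p}"

definition parent :: "('a \<rightharpoonup> 'a) \<Rightarrow> 'a \<Rightarrow> 'a" where
  "parent p v = the (p v)"

definition excedance :: "(nat \<rightharpoonup> nat) \<Rightarrow> nat \<Rightarrow> bool" where
  "excedance p i \<longleftrightarrow> i < parent p i"

text \<open>
  Words over \<open>{0, 1}\<close> are boolean lists, with \<open>True\<close> for the letter 1 and \<open>False\<close> for 0.
  The \<open>i\<close>-th letter, counted from 1, is the value at \<open>i\<close>.
\<close>

definition exc_word :: "nat \<Rightarrow> (nat \<rightharpoonup> nat) \<Rightarrow> bool list" where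
  "exc_word n p = map (excedance p) [1..<n+1]"

definition yy :: "nat \<Rightarrow> (nat \<rightharpoonup> nat) \<Rightarrow> nat" where
  "yy n p = card {(i, j). 1 \<le> i \<and> i < j \<and> j \<le> n \<and> parent p j < i \<and> j < parent p i}"

text \<open>The ring of integer polynomials in \<open>a\<close>, \<open>b\<close>, \<open>q\<close>, as an iterated polynomial ring
  with \<open>a\<close> the outermost and \<open>q\<close> the innermost indeterminate.\<close>

type_synonym int_poly3 = "int poly poly poly"

definition var_a :: int_poly3 where
  "var_a = [:0, 1:]"

definition var_b :: int_poly3 where
  "var_b = [:[:0, 1:]:]"

definition var_q :: int_poly3 where
  "var_q = [:[:[:0, 1:]:]:]"

text \<open>
  A tree on \<open>{0, \<dots>, n + 1}\<close> determines \<open>n\<close>, so summing over pairs of \<open>n\<close> and a tree in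
  \<open>alt_trees n\<close> is the same as summing over the union of all \<open>alt_trees n\<close>.
\<close>

definition bracket_trees :: "bool list \<Rightarrow> (nat \<times> (nat \<rightharpoonup> nat)) set" where
  "bracket_trees \<eta> = {(n, p). p \<in> alt_trees n \<and> exc_word n p = \<eta>}"

definition bracket :: "bool list \<Rightarrow> int_poly3" where
  "bracket \<eta> = (\<Sum>(n, p)\<in>bracket_trees \<eta>.
     var_a ^ card (children p 0) * var_b ^ card (children p (n + 1)) * var_q ^ yy n p)"

text \<open>The sum defining \<open>bracket\<close> is finite, hence not subject to the default value 0.\<close>

lemma finite_alt_trees: "finite (alt_trees n)"
proof (rule finite_subset)
  show "alt_trees n \<subseteq> {p. dom p = {0..n+1} - {0} \<and> ran p \<subseteq> {0..n+1}}"
    by (auto simp only: alt_trees_def alternative_tree_def rooted_tree_def)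
  show "finite {p::nat \<rightharpoonup> nat. dom p = {0..n+1} - {0} \<and> ran p \<subseteq> {0..n+1}}"
    by (rule finite_set_of_finite_maps) auto
qed

lemma finite_bracket_trees: "finite (bracket_trees \<eta>)"
proof (rule finite_subset)
  show "bracket_trees \<eta> \<subseteq> {length \<eta>} \<times> alt_trees (length \<eta>)"
    by (auto simp: bracket_trees_def exc_word_def simp del: upt_Suc)
qed (simp add: finite_alt_trees)

end

theory Submission
  imports Defs "HOL-Combinatorics.Transposition"
begin

text \<open>
  Alternative trees are the parent maps in which every vertex lies strictly between its parent and
  its grandparent, so only comparisons of labels along edges and paths of length two matter.
  Given a tree with word \<open>u10v\<close>, let \<open>k\<close> and \<open>k + 1\<close> be the vertices of the letters
  \<open>1\<close> and \<open>0\<close>. If \<open>k\<close> is a child of \<open>k + 1\<close>, or conversely, the child is a leaf; deleting it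
  gives a tree with word \<open>u0v\<close>, respectively \<open>u1v\<close>. Otherwise exchanging the labels \<open>k\<close> and
  \<open>k + 1\<close> gives an arbitrary tree with word \<open>u01v\<close>, and the pair \<open>(k, k + 1)\<close> is the only one
  whose contribution to \<open>yy\<close> changes. In \<open>0v\<close> the vertex \<open>1\<close> is a leaf attached to \<open>0\<close>, and in
  \<open>u1\<close> the vertex \<open>n\<close> is a leaf attached to \<open>n + 1\<close>, so these two are again leaf deletions.
\<close>

section \<open>Local description of alternative trees by betweenness\<close>

definition strictly_between :: "nat \<Rightarrow> nat \<Rightarrow> nat \<Rightarrow> bool" where
  "strictly_between x y z \<longleftrightarrow> x < y \<and> y < z \<or> z < y \<and> y < x"

definition nested_map :: "nat \<Rightarrow> (nat \<rightharpoonup> nat) \<Rightarrow> bool" where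
  "nested_map n p \<longleftrightarrow> dom p = {1..n+1} \<and> ran p \<subseteq> {0..n+1} \<and>
     (\<forall>i j g. p i = Some j \<longrightarrow> p j = Some g \<longrightarrow> strictly_between j i g)"

lemma rooted_tree_no_loop:
  assumes "rooted_tree S r p"
  shows "p v \<noteq> Some v"
proof
  assume loop: "p v = Some v"
  then have v: "v \<in> S" "v \<noteq> r"
    using assms unfolding rooted_tree_def by auto
  have "x = v" if "(v, x) \<in> (parent_rel p)\<^sup>*" for x
    using that by (induction rule: rtrancl_induct) (use loop in \<open>auto simp: parent_rel_def\<close>)
  moreover have "(v, r) \<in> (parent_rel p)\<^sup>*"
    using assms v(1) unfolding rooted_tree_def by auto
  ultimately show False using v(2) by blast
qed

text \<open>For a path from \<open>i\<close> to its parent \<open>j\<close> and on to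
  \<open>g\<close>, the condition at \<open>g\<close> puts \<open>i\<close> and \<open>j\<close> on
  the same side of \<open>g\<close>, and the condition at \<open>j\<close> then puts
  \<open>i\<close> between \<open>j\<close> and \<open>g\<close>.\<close>

lemma nested_map_if_alternative_tree:
  assumes "alternative_tree {0..n+1} 0 p"
  shows "nested_map n p"
proof -
  have rt: "rooted_tree {0..n+1} 0 p"
    and hi: "\<And>v w d. p v = Some w \<Longrightarrow> w < v \<Longrightarrow> d \<in> descendants p v \<Longrightarrow> d < v"
    and lo: "\<And>v w d. p v = Some w \<Longrightarrow> v < w \<Longrightarrow> d \<in> descendants p v \<Longrightarrow> v < d"
    using assms unfolding alternative_tree_def by simp_all
  have dom: "dom p = {0..n+1} - {0}" and ran: "ran p \<subseteq> {0..n+1}"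
    using rt unfolding rooted_tree_def by auto
  have noloop: "p v \<noteq> Some v" for v using rooted_tree_no_loop[OF rt] .
  have "strictly_between j i g" if ij: "p i = Some j" and jg: "p j = Some g" for i j g
  proof -
    have di: "i \<in> descendants p j" and dj: "j \<in> descendants p g"
      using ij jg by (auto simp: descendants_def parent_rel_def)
    then have dig: "i \<in> descendants p g"
      unfolding descendants_def mem_Collect_eq by (rule trancl_trans)
    have "i > 0" "j > 0" using dom ij jg by auto
    have neq: "i \<noteq> j" "j \<noteq> g" using noloop ij jg by auto
    have "i \<noteq> g"
      using hi[OF ij] lo[OF ij] dig neq by (metis less_irrefl linorder_neqE_nat)
    show ?thesis
    \<comment> \<open>The root has no parent, so no condition is available at \<open>g = 0\<close>;
      that it is the smallest label takes over this role.\<close>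
    proof (cases "g = 0")
      case True
      then show ?thesis
        using hi[OF jg _ di] \<open>i > 0\<close> \<open>j > 0\<close> by (auto simp: strictly_between_def)
    next
      case False
      have "g \<in> {0..n+1}" using ran jg by (auto intro: ranI)
      with False obtain h where h: "p g = Some h" using dom by blast
      have "g \<noteq> h" using noloop h by auto
      then consider "h < g" | "g < h" by linarith
      then show ?thesis
      proof cases
        case 1
        then have "j < g" "i < g" using hi[OF h] dj dig by auto
        then show ?thesis using lo[OF jg _ di] by (simp add: strictly_between_def)
      next
        case 2
        then have "g < j" "g < i" using lo[OF h] dj dig by auto
        then show ?thesis using hi[OF jg _ di] by (simp add: strictly_between_def)
      qed
    qed
  qed
  then show ?thesis unfolding nested_map_def using dom ran by auto
qed

lemma nested_map_Some:
  assumes "nested_map n p" "1 \<le> i" "i \<le> n + 1"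
  shows "\<exists>j. p i = Some j"
proof -
  have "i \<in> dom p" using assms unfolding nested_map_def by simp
  then show ?thesis by blast
qed

lemma nested_map_SomeD:
  assumes "nested_map n p" "p i = Some j"
  shows "1 \<le> i" "i \<le> n + 1" "j \<le> n + 1" "i \<noteq> j"
proof -
  have "i \<in> {1..n+1}" using assms unfolding nested_map_def by blast
  then show "1 \<le> i" "i \<le> n + 1" by simp_all
  have "j \<in> {0..n+1}" using assms unfolding nested_map_def by (blast intro: ranI)
  then show "j \<le> n + 1" by simp
  show "i \<noteq> j"
    using assms unfolding nested_map_def strictly_between_def by blast
qed

text \<open>A vertex lies strictly between its parent and grandparent, so the distance between the
  ends of an edge strictly increases on the way up. It is bounded by \<open>n + 1\<close>, hence the
  walk stops, and only \<open>0\<close> has no parent.\<close>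

lemma nested_map_reaches_root:
  assumes p: "nested_map n p" and "v \<le> n + 1"
  shows "(v, 0) \<in> (parent_rel p)\<^sup>*"
  using assms(2)
proof (induction "n + 1 - (max v (the (p v)) - min v (the (p v)))" arbitrary: v rule: less_induct)
  case less
  show ?case
  proof (cases "v = 0")
    case False
    then obtain w where w: "p v = Some w" "w \<le> n + 1"
      using nested_map_Some[OF p, of v] nested_map_SomeD(3)[OF p] less.prems by auto
    have "(w, 0) \<in> (parent_rel p)\<^sup>*"
    \<comment> \<open>The parent \<open>0\<close> is treated apart because the measure would involve
      the unspecified value \<open>the (p 0)\<close>.\<close>
    proof (cases "w = 0")
      case False
      then obtain g where g: "p w = Some g" "g \<le> n + 1"
        using nested_map_Some[OF p, of w] nested_map_SomeD(3)[OF p] w(2) by auto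
      have "strictly_between w v g" using p w(1) g(1) unfolding nested_map_def by blast
      then have "n + 1 - (max w g - min w g) < n + 1 - (max v w - min v w)"
        using w(2) g(2) less.prems unfolding strictly_between_def by linarith
      then show ?thesis using less.hyps[of w] w g by simp
    qed simp
    then show ?thesis
      using w by (auto simp: parent_rel_def intro: converse_rtrancl_into_rtrancl)
  qed simp
qed

text \<open>The open interval between a vertex and its parent lies inside the one between that
  parent and the grandparent. These nested intervals carry the local condition over to all
  descendants, which yields both order conditions of an alternative tree.\<close>

lemma nested_map_descendant_between:
  assumes p: "nested_map n p" and "d \<in> descendants p v" "p v = Some w"
  shows "strictly_between v d w"
proof -
  have "(d, v) \<in> (parent_rel p)\<^sup>+" using assms(2) by (simp add: descendants_def)
  then show ?thesis using assms(3)
  proof (induction arbitrary: w rule: trancl_induct)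
    case (base y)
    then show ?case using p unfolding nested_map_def parent_rel_def by blast
  next
    case (step y z)
    then have "p y = Some z" by (simp add: parent_rel_def)
    then have "strictly_between y d z" "strictly_between z y w"
      using step p unfolding nested_map_def by blast+
    then show ?case unfolding strictly_between_def by linarith
  qed
qed

lemma alt_trees_eq_nested_maps: "alt_trees n = {p. nested_map n p}"
proof -
  have "alternative_tree {0..n+1} 0 p" if p: "nested_map n p" for p
  proof -
    have "rooted_tree {0..n+1} 0 p"
      using p nested_map_reaches_root[OF p] unfolding rooted_tree_def nested_map_def by auto
    moreover have "Min {0..n+1} = 0" by (rule Min_eqI) auto
    moreover have "d < v" if "p v = Some w" "w < v" "d \<in> descendants p v" for v w d
      using nested_map_descendant_between[OF p that(3,1)] that(2)
      by (auto simp: strictly_between_def)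
    moreover have "v < d" if "p v = Some w" "v < w" "d \<in> descendants p v" for v w d
      using nested_map_descendant_between[OF p that(3,1)] that(2)
      by (auto simp: strictly_between_def)
    ultimately show ?thesis unfolding alternative_tree_def by simp
  qed
  then show ?thesis
    using nested_map_if_alternative_tree by (auto simp: alt_trees_def)
qed

section \<open>Trees with a prescribed excedance word\<close>

definition trees_of_word :: "bool list \<Rightarrow> (nat \<rightharpoonup> nat) set" where
  "trees_of_word w = {p. nested_map (length w) p \<and>
     (\<forall>i j. 1 \<le> i \<longrightarrow> i \<le> length w \<longrightarrow> p i = Some j \<longrightarrow> w ! (i - 1) = (i < j))}"

definition tree_weight :: "nat \<Rightarrow> (nat \<rightharpoonup> nat) \<Rightarrow> int_poly3" where
  "tree_weight n p =
     var_a ^ card (children p 0) * var_b ^ card (children p (n + 1)) * var_q ^ yy n p"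

lemma bracket_trees_eq: "bracket_trees w = Pair (length w) ` trees_of_word w"
proof -
  have "exc_word n p = w \<longleftrightarrow> n = length w \<and>
      (\<forall>i j. 1 \<le> i \<longrightarrow> i \<le> length w \<longrightarrow> p i = Some j \<longrightarrow> w ! (i - 1) = (i < j))"
    if p: "nested_map n p" for n p
  proof -
    have "exc_word n p = w \<longleftrightarrow> n = length w \<and> (\<forall>i<n. excedance p (Suc i) = w ! i)"
      by (auto simp: exc_word_def list_eq_iff_nth_eq simp del: upt_Suc)
    also have "(\<forall>i<n. excedance p (Suc i) = w ! i) \<longleftrightarrow>
        (\<forall>i\<in>{1..n}. w ! (i - 1) = excedance p i)"
      unfolding image_Suc_lessThan[symmetric] by auto
    also have "\<dots> \<longleftrightarrow> (\<forall>i\<in>{1..n}. \<forall>j. p i = Some j \<longrightarrow> w ! (i - 1) = (i < j))"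
    proof (rule ball_cong)
      fix i assume "i \<in> {1..n}"
      then obtain x where "p i = Some x" using nested_map_Some[OF p, of i] by auto
      then show "w ! (i - 1) = excedance p i \<longleftrightarrow> (\<forall>j. p i = Some j \<longrightarrow> w ! (i - 1) = (i < j))"
        by (simp add: excedance_def parent_def)
    qed simp
    finally show ?thesis by auto
  qed
  then have "(n, p) \<in> bracket_trees w \<longleftrightarrow> n = length w \<and> p \<in> trees_of_word w" for n p
    unfolding bracket_trees_def trees_of_word_def alt_trees_eq_nested_maps mem_Collect_eq prod.case
    by metis
  then show ?thesis by auto
qed

lemma finite_trees_of_word: "finite (trees_of_word w)"
proof (rule finite_imageD)
  show "finite (Pair (length w) ` trees_of_word w)"
    using finite_bracket_trees[of w] by (simp only: bracket_trees_eq)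
qed (simp add: inj_on_def)

lemma bracket_eq: "bracket w = (\<Sum>p\<in>trees_of_word w. tree_weight (length w) p)"
  unfolding bracket_def bracket_trees_eq
  by (subst sum.reindex) (simp_all add: inj_on_def tree_weight_def)

lemma trees_of_word_nested: "p \<in> trees_of_word w \<Longrightarrow> nested_map (length w) p"
  by (simp add: trees_of_word_def)

lemma trees_of_word_less_iff:
  "p \<in> trees_of_word w \<Longrightarrow> p i = Some j \<Longrightarrow> i \<le> length w \<Longrightarrow> i < j \<longleftrightarrow> w ! (i - 1)"
  using nested_map_SomeD(1)[OF trees_of_word_nested, of p w i j]
  unfolding trees_of_word_def mem_Collect_eq by blast

lemma trees_of_word_betweenD:
  "p \<in> trees_of_word w \<Longrightarrow> p i = Some j \<Longrightarrow> p j = Some g \<Longrightarrow> strictly_between j i g"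
  by (simp add: trees_of_word_def nested_map_def)

text \<open>The bound \<open>1 \<le> i\<close> is absorbed by \<open>p i = Some x\<close>, since
  \<open>0\<close> has no parent. Without \<open>the\<close>, the counted set can be carried along a
  relabelling pointwise.\<close>

lemma yy_eq:
  assumes "nested_map n p"
  shows "yy n p = card {(i, j). i < j \<and> j \<le> n \<and> (\<exists>x y. p i = Some x \<and> p j = Some y \<and> y < i \<and> j < x)}"
proof -
  have "1 \<le> i \<and> i < j \<and> j \<le> n \<and> parent p j < i \<and> j < parent p i \<longleftrightarrow>
      i < j \<and> j \<le> n \<and> (\<exists>x y. p i = Some x \<and> p j = Some y \<and> y < i \<and> j < x)" for i j
  proof (cases "1 \<le> i \<and> i < j \<and> j \<le> n")
    case True
    then obtain x y where "p i = Some x" "p j = Some y"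
      using nested_map_Some[OF assms, of i] nested_map_Some[OF assms, of j] by auto
    then show ?thesis using True by (simp add: parent_def)
  next
    case False
    moreover have "p i = None" if "\<not> 1 \<le> i"
      using nested_map_SomeD(1)[OF assms, of i] that by (cases "p i") auto
    ultimately show ?thesis by (cases "1 \<le> i") auto
  qed
  then show ?thesis unfolding yy_def by (simp only:)
qed


lemma trees_of_wordI:
  assumes "nested_map (length w) p"
    and "\<And>i j. 1 \<le> i \<Longrightarrow> i \<le> length w \<Longrightarrow> p i = Some j \<Longrightarrow> w ! (i - 1) = (i < j)"
  shows "p \<in> trees_of_word w"
  using assms by (simp add: trees_of_word_def)

section \<open>Inserting and deleting a leaf\<close>

definition skip :: "nat \<Rightarrow> nat \<Rightarrow> nat" where
  "skip k i = (if i < k then i else Suc i)"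

text \<open>Together with \<open>skip\<close>, these are the codegeneracy and coface maps of the
  simplex category: \<open>skip k\<close> is the increasing bijection onto the labels other than
  \<open>k\<close>, and \<open>unskip k\<close> inverts it, with a dummy value at
  \<open>k\<close>.\<close>

definition unskip :: "nat \<Rightarrow> nat \<Rightarrow> nat" where
  "unskip k i = (if i \<le> k then i else i - 1)"

lemma skip_less_iff [simp]: "skip k i < skip k j \<longleftrightarrow> i < j"
  by (auto simp: skip_def)

lemma skip_eq_iff [simp]: "skip k i = skip k j \<longleftrightarrow> i = j"
  by (auto simp: skip_def)

lemma skip_neq [simp]: "skip k i \<noteq> k" "k \<noteq> skip k i"
  by (auto simp: skip_def)

lemma unskip_skip [simp]: "unskip k (skip k i) = i"
  by (auto simp: skip_def unskip_def)

lemma skip_unskip: "i \<noteq> k \<Longrightarrow> skip k (unskip k i) = i"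
  by (auto simp: skip_def unskip_def)

lemma skip_cases:
  obtains "i = k" | i' where "i = skip k i'"
  using skip_unskip by metis

lemma strictly_between_skip [simp]:
  "strictly_between (skip k x) (skip k y) (skip k z) \<longleftrightarrow> strictly_between x y z"
  by (simp add: strictly_between_def)

lemma skip_ge_1_iff: "1 \<le> k \<Longrightarrow> 1 \<le> skip k i \<longleftrightarrow> 1 \<le> i"
  by (auto simp: skip_def)

lemma skip_le_Suc_iff: "k \<le> Suc n \<Longrightarrow> skip k i \<le> Suc n \<longleftrightarrow> i \<le> n"
  by (auto simp: skip_def)

lemma nth_skip:
  assumes "1 \<le> i"
  shows "(u @ x # v) ! (skip (Suc (length u)) i - 1) = (u @ v) ! (i - 1)"
  using assms by (auto simp: skip_def nth_append nth_Cons' Suc_diff_le)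

text \<open>The attachment vertex \<open>m\<close> is given in the new labelling, whereas old
  parents are relabelled by \<open>skip k\<close>.\<close>

definition insert_leaf :: "nat \<Rightarrow> nat \<Rightarrow> (nat \<rightharpoonup> nat) \<Rightarrow> nat \<rightharpoonup> nat" where
  "insert_leaf k m p = (\<lambda>i. if i = k then Some m else map_option (skip k) (p (unskip k i)))"

definition delete_leaf :: "nat \<Rightarrow> (nat \<rightharpoonup> nat) \<Rightarrow> nat \<rightharpoonup> nat" where
  "delete_leaf k p = (\<lambda>i. map_option (unskip k) (p (skip k i)))"

lemma insert_leaf_same [simp]: "insert_leaf k m p k = Some m"
  by (simp add: insert_leaf_def)

lemma insert_leaf_skip [simp]: "insert_leaf k m p (skip k i) = map_option (skip k) (p i)"
  by (simp add: insert_leaf_def)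

lemma delete_insert_leaf [simp]: "delete_leaf k (insert_leaf k m p) = p"
  by (simp add: delete_leaf_def option.map_comp o_def option.map_ident)

text \<open>No value of \<open>skip k\<close> equals \<open>k\<close>, so when \<open>m\<close>
  differs from \<open>k\<close> the new vertex has no children. The only new path of length two
  starts at \<open>k\<close>, and \<open>attach\<close> is the betweenness condition for it.\<close>

lemma insert_leaf_in_trees_of_word:
  assumes p: "p \<in> trees_of_word (u @ v)" and k: "k = Suc (length u)"
    and m: "m \<le> length (u @ v) + 2" and x: "x \<longleftrightarrow> k < m"
    and attach: "\<And>g. insert_leaf k m p m = Some g \<Longrightarrow> strictly_between m k g"
  shows "insert_leaf k m p \<in> trees_of_word (u @ x # v)"
proof (rule trees_of_wordI)
  let ?n = "length (u @ v)" and ?q = "insert_leaf k m p"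
  have nm: "nested_map ?n p" using p by (rule trees_of_word_nested)
  \<comment> \<open>The enlarged tree has \<open>Suc ?n\<close> letters but largest label
    \<open>Suc (Suc ?n)\<close>; the two upper bounds serve letter positions and vertices
    respectively.\<close>
  have kn: "1 \<le> k" "k \<le> Suc ?n" "k \<le> Suc (Suc ?n)" using k by auto
  have domp: "p i \<noteq> None \<longleftrightarrow> 1 \<le> i \<and> i \<le> Suc ?n" for i
    using nm by (auto simp: nested_map_def dom_def set_eq_iff)
  have "i \<in> dom ?q \<longleftrightarrow> i \<in> {1..length (u @ x # v) + 1}" for i
  proof (cases rule: skip_cases[of i k])
    case 1
    then show ?thesis using kn by (auto simp: domIff)
  next
    case (2 i')
    then have "i \<in> dom ?q \<longleftrightarrow> p i' \<noteq> None" by (simp add: domIff)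
    then show ?thesis
      unfolding domp 2 using skip_ge_1_iff[OF kn(1), of i'] skip_le_Suc_iff[OF kn(3), of i'] by simp
  qed
  then have "dom ?q = {1..length (u @ x # v) + 1}" by blast
  moreover have "j \<le> length (u @ x # v) + 1" if ij: "?q i = Some j" for i j
  proof (cases rule: skip_cases[of i k])
    case 1
    then show ?thesis using ij m by simp
  next
    case (2 i')
    then obtain j' where "p i' = Some j'" "j = skip k j'"
      using ij by (cases "p i'") auto
    then show ?thesis
      using nested_map_SomeD(3)[OF nm] skip_le_Suc_iff[OF kn(3), of j'] by simp
  qed
  moreover have "strictly_between j i g" if ij: "?q i = Some j" and jg: "?q j = Some g" for i j g
  proof (cases rule: skip_cases[of i k])
    case 1
    then show ?thesis using ij jg attach by simp
  next
    case (2 i')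
    then obtain j' where j': "p i' = Some j'" "j = skip k j'"
      using ij by (cases "p i'") auto
    then obtain g' where "p j' = Some g'" "g = skip k g'"
      using jg by (cases "p j'") auto
    then show ?thesis using 2 j' trees_of_word_betweenD[OF p] by simp
  qed
  ultimately show "nested_map (length (u @ x # v)) ?q"
    unfolding nested_map_def by (auto simp: ran_def)
  show "(u @ x # v) ! (i - 1) = (i < j)"
    if i: "1 \<le> i" "i \<le> length (u @ x # v)" "?q i = Some j" for i j
  proof (cases rule: skip_cases[of i k])
    case 1
    then show ?thesis using i x k by simp
  next
    case (2 i')
    then obtain j' where j': "p i' = Some j'" "j = skip k j'"
      using i by (cases "p i'") auto
    have "1 \<le> i'" "i' \<le> ?n"
      using i 2 skip_ge_1_iff[OF kn(1), of i'] skip_le_Suc_iff[OF kn(2), of i'] by auto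
    then show ?thesis
      using j' 2 trees_of_word_less_iff[OF p j'(1)] nth_skip[of i' u x v] k by simp
  qed
qed

lemma delete_leaf_in_trees_of_word:
  assumes q: "q \<in> trees_of_word (u @ x # v)" and k: "k = Suc (length u)"
    and qk: "q k = Some m" and m: "m = Suc k \<or> k = Suc m"
  shows "delete_leaf k q \<in> trees_of_word (u @ v)"
    and "insert_leaf k m (delete_leaf k q) = q"
proof -
  let ?n = "length (u @ v)" and ?p = "delete_leaf k q"
  have nm: "nested_map (Suc ?n) q" using trees_of_word_nested[OF q] by simp
  have kn: "1 \<le> k" "k \<le> Suc ?n" "k \<le> Suc (Suc ?n)" using k by auto
  \<comment> \<open>A child of \<open>k\<close> would lie strictly between the consecutive integers
    \<open>k\<close> and \<open>m\<close>. Hence \<open>unskip k\<close> is only applied to parents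
    other than \<open>k\<close>, where it is injective.\<close>
  have leaf: "q i \<noteq> Some k" for i
    using trees_of_word_betweenD[OF q _ qk, of i] m by (auto simp: strictly_between_def)
  have p_iff: "?p i = Some j \<longleftrightarrow> q (skip k i) = Some (skip k j)" for i j
    using leaf[of "skip k i"] skip_unskip by (auto simp: delete_leaf_def)
  have domq: "q i \<noteq> None \<longleftrightarrow> 1 \<le> i \<and> i \<le> Suc (Suc ?n)" for i
    using nm by (auto simp: nested_map_def dom_def set_eq_iff)
  show "?p \<in> trees_of_word (u @ v)"
  proof (rule trees_of_wordI)
    have "?p i \<noteq> None \<longleftrightarrow> i \<in> {1..?n + 1}" for i
    proof -
      have "?p i \<noteq> None \<longleftrightarrow> q (skip k i) \<noteq> None" by (simp add: delete_leaf_def)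
      then show ?thesis
        unfolding domq using skip_ge_1_iff[OF kn(1), of i] skip_le_Suc_iff[OF kn(3), of i] by simp
    qed
    then have "dom ?p = {1..?n + 1}" by (auto simp only: dom_def)
    moreover have "j \<le> ?n + 1" if "?p i = Some j" for i j
      using that nested_map_SomeD(3)[OF nm] skip_le_Suc_iff[OF kn(3), of j] by (simp add: p_iff)
    moreover have "strictly_between j i g" if "?p i = Some j" "?p j = Some g" for i j g
      using that trees_of_word_betweenD[OF q, of "skip k i" "skip k j" "skip k g"]
      by (simp add: p_iff)
    ultimately show "nested_map ?n ?p"
      unfolding nested_map_def by (auto simp: ran_def)
    show "(u @ v) ! (i - 1) = (i < j)" if i: "1 \<le> i" "i \<le> ?n" "?p i = Some j" for i j
    proof -
      have "skip k i \<le> length (u @ x # v)" using i skip_le_Suc_iff[OF kn(2), of i] by simp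
      then show ?thesis
        using trees_of_word_less_iff[OF q i(3)[unfolded p_iff]] nth_skip[OF i(1), of u x v] k
        by simp
    qed
  qed
  show "insert_leaf k m ?p = q"
  proof
    fix i
    show "insert_leaf k m ?p i = q i"
    proof (cases rule: skip_cases[of i k])
      case 1
      then show ?thesis using qk by simp
    next
      case (2 i')
      show ?thesis
      proof (cases "?p i'")
        case None
        then show ?thesis by (simp add: 2) (simp add: delete_leaf_def)
      next
        case (Some j)
        then show ?thesis using p_iff by (simp add: 2)
      qed
    qed
  qed
qed

lemma finite_children: "nested_map n p \<Longrightarrow> finite (children p c)"
  by (rule finite_subset[of _ "dom p"]) (auto simp: children_def nested_map_def)

lemma card_children_insert_leaf:
  assumes "nested_map n p"
  shows "card (children (insert_leaf k m p) (skip k c)) =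
    card (children p c) + (if m = skip k c then 1 else 0)"
proof -
  have "i \<in> children (insert_leaf k m p) (skip k c) \<longleftrightarrow>
      i \<in> skip k ` children p c \<union> (if m = skip k c then {k} else {})" for i
    by (cases rule: skip_cases[of i k]) (auto simp: children_def)
  then have "children (insert_leaf k m p) (skip k c) =
      skip k ` children p c \<union> (if m = skip k c then {k} else {})"
    by blast
  moreover have "card (skip k ` children p c) = card (children p c)"
    by (rule card_image) (simp add: inj_on_def)
  moreover have "k \<notin> skip k ` children p c" by auto
  ultimately show ?thesis
    using finite_children[OF assms, of c] by simp
qed

text \<open>The new leaf takes part in no counted pair: as first entry it would need some
  \<open>j\<close> with \<open>k < j < m\<close>, as second entry some \<open>i\<close> with
  \<open>m < i < k\<close>, and \<open>k\<close> and \<open>m\<close> are consecutive. All other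
  pairs are transported by \<open>skip k\<close>.\<close>

lemma yy_insert_leaf:
  assumes p: "nested_map n p" and q: "nested_map (Suc n) (insert_leaf k m p)"
    and k: "k \<le> Suc n" and m: "m = Suc k \<or> k = Suc m"
  shows "yy (Suc n) (insert_leaf k m p) = yy n p"
proof -
  let ?q = "insert_leaf k m p"
  let ?Y = "\<lambda>n p. {(i, j). i < j \<and> j \<le> n \<and>
    (\<exists>x y. p i = Some x \<and> p j = Some y \<and> y < i \<and> j < (x::nat))}"
  have "(i, j) \<in> ?Y (Suc n) ?q \<longleftrightarrow> (i, j) \<in> map_prod (skip k) (skip k) ` ?Y n p" for i j
  proof (cases rule: skip_cases[of i k])
    case 1
    then show ?thesis using m by auto
  next
    case i: (2 i')
    show ?thesis
    proof (cases rule: skip_cases[of j k])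
      case 1
      then show ?thesis using m i by auto
    next
      case j: (2 j')
      have "(i, j) \<in> ?Y (Suc n) ?q \<longleftrightarrow> (i', j') \<in> ?Y n p"
        using skip_le_Suc_iff[OF k, of j'] by (auto simp: i j)
      then show ?thesis by (auto simp: i j)
    qed
  qed
  then have "?Y (Suc n) ?q = map_prod (skip k) (skip k) ` ?Y n p" by auto
  then show ?thesis
    unfolding yy_eq[OF p] yy_eq[OF q]
    by (simp add: card_image inj_on_def)
qed

text \<open>Insertion is a bijection with inverse \<open>delete_leaf k\<close>. The weight changes
  only if the leaf hangs from \<open>0\<close> or from \<open>length (u @ v) + 2\<close>, the
  largest label of the enlarged tree.\<close>

lemma sum_tree_weight_insert_leaf:
  assumes k: "k = Suc (length u)" and m: "m = Suc k \<or> k = Suc m" and x: "x \<longleftrightarrow> k < m"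
    and attach: "\<And>p g. p \<in> trees_of_word (u @ v) \<Longrightarrow> insert_leaf k m p m = Some g \<Longrightarrow>
      strictly_between m k g"
  shows "(\<Sum>q | q \<in> trees_of_word (u @ x # v) \<and> q k = Some m. tree_weight (length (u @ x # v)) q) =
    (if m = 0 then var_a else 1) * (if m = length (u @ v) + 2 then var_b else 1) * bracket (u @ v)"
proof -
  let ?n = "length (u @ v)"
  have kn: "1 \<le> k" "k \<le> Suc ?n" "m \<le> ?n + 2" using k m by auto
  have ins: "insert_leaf k m p \<in> trees_of_word (u @ x # v)" if "p \<in> trees_of_word (u @ v)" for p
    using insert_leaf_in_trees_of_word[OF that k kn(3) x attach[OF that]] .
  have bij: "bij_betw (insert_leaf k m) (trees_of_word (u @ v))
      {q. q \<in> trees_of_word (u @ x # v) \<and> q k = Some m}"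
    by (rule bij_betw_byWitness[where f' = "delete_leaf k"])
      (use ins delete_leaf_in_trees_of_word[OF _ k _ m] in auto)
  have wt: "tree_weight (length (u @ x # v)) (insert_leaf k m p) =
      (if m = 0 then var_a else 1) * (if m = ?n + 2 then var_b else 1) * tree_weight ?n p"
    if p: "p \<in> trees_of_word (u @ v)" for p
  proof -
    note nm = trees_of_word_nested[OF p]
    have "skip k 0 = 0" "skip k (Suc ?n) = Suc (Suc ?n)" using kn by (auto simp: skip_def)
    then have "card (children (insert_leaf k m p) 0) = card (children p 0) + (if m = 0 then 1 else 0)"
      "card (children (insert_leaf k m p) (Suc (Suc ?n))) =
        card (children p (Suc ?n)) + (if m = Suc (Suc ?n) then 1 else 0)"
      using card_children_insert_leaf[OF nm, of k m 0]
        card_children_insert_leaf[OF nm, of k m "Suc ?n"] by simp_all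
    moreover have "yy (Suc ?n) (insert_leaf k m p) = yy ?n p"
      using yy_insert_leaf[OF nm _ kn(2) m] trees_of_word_nested[OF ins[OF p]] by simp
    ultimately show ?thesis
      by (simp add: tree_weight_def mult.assoc mult.left_commute)
  qed
  show ?thesis
    unfolding bracket_eq sum_distrib_left sum.reindex_bij_betw[OF bij, symmetric]
    by (rule sum.cong) (simp_all only: wt)
qed

text \<open>The vertex \<open>k + 1\<close> can carry the leaf \<open>k\<close> exactly when its own
  parent is below \<open>k\<close>. This is forced if \<open>k + 1\<close> has letter 0, and also if
  it is the largest label, which is the case \<open>v = []\<close> with its factor
  \<open>var_b\<close>.\<close>

lemma sum_tree_weight_parent_Suc:
  assumes k: "k = Suc (length u)" and v: "v = [] \<or> \<not> hd v"
  shows "(\<Sum>q | q \<in> trees_of_word (u @ True # v) \<and> q k = Some (Suc k).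
      tree_weight (length (u @ True # v)) q) = (if v = [] then var_b else 1) * bracket (u @ v)"
proof -
  have "strictly_between (Suc k) k g"
    if p: "p \<in> trees_of_word (u @ v)" and g: "insert_leaf k (Suc k) p (Suc k) = Some g" for p g
  proof -
    have "skip k k = Suc k" by (simp add: skip_def)
    with g insert_leaf_skip[of k "Suc k" p k] obtain h where h: "p k = Some h" "g = skip k h"
      by (cases "p k") auto
    note hD = nested_map_SomeD[OF trees_of_word_nested[OF p] h(1)]
    have "h < k"
    proof (cases v)
      case Nil
      then show ?thesis using hD k by simp
    next
      case (Cons y v')
      then have "\<not> k < h"
        using trees_of_word_less_iff[OF p h(1)] v k by (simp add: nth_append)
      then show ?thesis using hD by simp
    qed
    then show ?thesis by (simp add: strictly_between_def h(2) skip_def)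
  qed
  then show ?thesis
    using sum_tree_weight_insert_leaf[OF k, of "Suc k" True v] k by simp
qed

text \<open>Mirror image of the preceding case: the parent of the attachment vertex
  \<open>length u\<close> must be larger, which letter 1 guarantees. For \<open>u = []\<close> the
  attachment vertex is the root, so there is no such condition and a factor \<open>var_a\<close>
  appears.\<close>

lemma sum_tree_weight_parent_pred:
  assumes u: "u = [] \<or> last u"
  shows "(\<Sum>q | q \<in> trees_of_word (u @ False # v) \<and> q (Suc (length u)) = Some (length u).
      tree_weight (length (u @ False # v)) q) = (if u = [] then var_a else 1) * bracket (u @ v)"
proof -
  let ?m = "length u"
  have "strictly_between ?m (Suc ?m) g"
    if p: "p \<in> trees_of_word (u @ v)" and g: "insert_leaf (Suc ?m) ?m p ?m = Some g" for p g
  proof -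
    have "skip (Suc ?m) ?m = ?m" by (simp add: skip_def)
    with g insert_leaf_skip[of "Suc ?m" ?m p ?m]
    obtain h where h: "p ?m = Some h" "g = skip (Suc ?m) h"
      by (cases "p ?m") auto
    note hD = nested_map_SomeD[OF trees_of_word_nested[OF p] h(1)]
    have "u \<noteq> []" using hD(1) by auto
    then have "(u @ v) ! (?m - 1)" using u by (simp add: nth_append last_conv_nth)
    then have "?m < h" using trees_of_word_less_iff[OF p h(1)] by simp
    then show ?thesis by (simp add: strictly_between_def h(2) skip_def)
  qed
  then show ?thesis
    using sum_tree_weight_insert_leaf[of "Suc ?m" u ?m False v] by simp
qed

section \<open>Exchanging the labels k and k + 1\<close>

definition adjacent :: "nat \<Rightarrow> nat \<Rightarrow> nat \<Rightarrow> bool" where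
  "adjacent k i j \<longleftrightarrow> i = k \<and> j = Suc k \<or> i = Suc k \<and> j = k"

text \<open>The pairs described by \<open>adjacent\<close> are exactly those whose order the
  transposition reverses.\<close>

lemma transpose_less_iff:
  "\<not> adjacent k i j \<Longrightarrow> transpose k (Suc k) i < transpose k (Suc k) j \<longleftrightarrow> i < j"
  unfolding adjacent_def transpose_def by (simp; linarith)

lemma adjacent_transpose_iff:
  "adjacent k (transpose k (Suc k) i) (transpose k (Suc k) j) \<longleftrightarrow> adjacent k i j"
  unfolding adjacent_def transpose_def by (simp; linarith)

lemma adjacent_sym: "adjacent k i j \<longleftrightarrow> adjacent k j i"
  by (auto simp: adjacent_def)

lemma nth_transpose:
  assumes "k = Suc (length u)" "1 \<le> i"
  shows "(u @ [y, x] @ v) ! (transpose k (Suc k) i - 1) = (u @ [x, y] @ v) ! (i - 1)"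
proof -
  consider "i < k" | "i = k" | "i = Suc k" | "i > Suc k" by linarith
  then show ?thesis
  proof cases
    case 4
    then obtain d where "i = d + Suc (Suc k)"
      using less_imp_Suc_add[of "Suc k" i] by (auto simp: add.commute)
    then show ?thesis using assms by (simp add: nth_append)
  qed (use assms in \<open>auto simp: nth_append\<close>)
qed

definition swap_labels :: "nat \<Rightarrow> (nat \<rightharpoonup> nat) \<Rightarrow> nat \<rightharpoonup> nat" where
  "swap_labels k p =
    (\<lambda>i. map_option (transpose k (Suc k)) (p (transpose k (Suc k) i)))"

lemma swap_labels_transpose [simp]:
  "swap_labels k p (transpose k (Suc k) i) = map_option (transpose k (Suc k)) (p i)"
  by (simp add: swap_labels_def)

lemma swap_labels_swap_labels [simp]: "swap_labels k (swap_labels k p) = p"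
  by (simp add: swap_labels_def option.map_comp o_def option.map_ident)

lemma swap_labels_Some_iff:
  "swap_labels k p i = Some j \<longleftrightarrow> p (transpose k (Suc k) i) = Some (transpose k (Suc k) j)"
  by (cases "p (transpose k (Suc k) i)")
    (auto simp: swap_labels_def transpose_eq_iff)

text \<open>Exchanging the labels \<open>k\<close> and \<open>k + 1\<close> then affects none of the comparisons
  that \<open>nested_map\<close> and the word depend on.\<close>

definition separated :: "nat \<Rightarrow> (nat \<rightharpoonup> nat) \<Rightarrow> bool" where
  "separated k p \<longleftrightarrow> (\<forall>i j. p i = Some j \<longrightarrow> \<not> adjacent k i j) \<and>
     (\<forall>i j g. p i = Some j \<longrightarrow> p j = Some g \<longrightarrow> \<not> adjacent k i g)"

lemma separated_swap_labels: "separated k p \<Longrightarrow> separated k (swap_labels k p)"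
  unfolding separated_def swap_labels_Some_iff
  using adjacent_transpose_iff by blast

text \<open>Edges along a path to the root alternate between going up and going down, so a vertex
  and its grandparent carry the same letter. As \<open>x\<close> and \<open>y\<close> differ,
  \<open>k\<close> and \<open>k + 1\<close> are never at distance two on such a path, and only an
  edge between them has to be excluded.\<close>

lemma trees_of_word_separated:
  assumes p: "p \<in> trees_of_word (u @ [x, y] @ v)" and k: "k = Suc (length u)" and xy: "x \<noteq> y"
    and "p k \<noteq> Some (Suc k)" "p (Suc k) \<noteq> Some k"
  shows "separated k p"
proof -
  have "\<not> adjacent k i g" if i: "p i = Some j" and j: "p j = Some g" for i j g
  proof
    assume adj: "adjacent k i g"
    then have len: "i \<le> length (u @ [x, y] @ v)" "g \<le> length (u @ [x, y] @ v)" "1 \<le> g"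
      using k by (auto simp: adjacent_def)
    then obtain h where h: "p g = Some h"
      using nested_map_Some[OF trees_of_word_nested[OF p], of g] by auto
    have "i < j \<longleftrightarrow> g < h"
      using trees_of_word_betweenD[OF p i j] trees_of_word_betweenD[OF p j h]
      unfolding strictly_between_def by linarith
    then have "(u @ [x, y] @ v) ! (i - 1) = (u @ [x, y] @ v) ! (g - 1)"
      using trees_of_word_less_iff[OF p i len(1)] trees_of_word_less_iff[OF p h len(2)] by simp
    then show False using adj xy k by (auto simp: adjacent_def nth_append)
  qed
  then show ?thesis
    using assms(4,5) unfolding separated_def adjacent_def by blast
qed

lemma swap_labels_in_trees_of_word:
  assumes p: "p \<in> trees_of_word (u @ [x, y] @ v)" and k: "k = Suc (length u)"
    and sep: "separated k p"
  shows "swap_labels k p \<in> trees_of_word (u @ [y, x] @ v)"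
proof (rule trees_of_wordI)
  let ?n = "length (u @ [y, x] @ v)" and ?s = "transpose k (Suc k)" and ?q = "swap_labels k p"
  have nm: "nested_map ?n p" using trees_of_word_nested[OF p] by simp
  have range: "?s i \<in> {1..?n + 1} \<longleftrightarrow> i \<in> {1..?n + 1}" "?s i \<le> ?n + 1 \<longleftrightarrow> i \<le> ?n + 1"
    "?s i \<in> {1..?n} \<longleftrightarrow> i \<in> {1..?n}" for i
    using k by (auto simp: transpose_def)
  have "i \<in> dom ?q \<longleftrightarrow> i \<in> {1..?n + 1}" for i
  proof -
    have "i \<in> dom ?q \<longleftrightarrow> ?s i \<in> dom p" by (simp add: domIff swap_labels_def)
    also have "\<dots> \<longleftrightarrow> i \<in> {1..?n + 1}" using nm range(1) unfolding nested_map_def by blast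
    finally show ?thesis .
  qed
  then have "dom ?q = {1..?n + 1}" by blast
  moreover have "j \<le> ?n + 1" if "?q i = Some j" for i j
    using that nested_map_SomeD(3)[OF nm] range(2) unfolding swap_labels_Some_iff by blast
  moreover have "strictly_between j i g" if "?q i = Some j" "?q j = Some g" for i j g
  proof -
    note pp = that[unfolded swap_labels_Some_iff]
    then have "\<not> adjacent k j i" "\<not> adjacent k i g" "\<not> adjacent k i j" "\<not> adjacent k g i"
      using sep adjacent_transpose_iff adjacent_sym unfolding separated_def by blast+
    then show ?thesis
      using trees_of_word_betweenD[OF p pp] by (simp add: strictly_between_def transpose_less_iff)
  qed
  ultimately show "nested_map ?n ?q"
    unfolding nested_map_def by (auto simp: ran_def)
  show "(u @ [y, x] @ v) ! (i - 1) = (i < j)" if i: "1 \<le> i" "i \<le> ?n" "?q i = Some j" for i j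
  proof -
    have pi: "p (?s i) = Some (?s j)" using i(3) unfolding swap_labels_Some_iff .
    then have "\<not> adjacent k i j"
      using sep adjacent_transpose_iff unfolding separated_def by blast
    moreover have "?s i \<in> {1..?n}" using range(3) i by simp
    then have "?s i \<le> length (u @ [x, y] @ v)" by simp
    ultimately show ?thesis
      using trees_of_word_less_iff[OF p pi] nth_transpose[OF k i(1), of x y v]
      by (simp add: transpose_less_iff)
  qed
qed

lemma card_children_swap_labels:
  assumes "c \<noteq> k" "c \<noteq> Suc k"
  shows "card (children (swap_labels k p) c) = card (children p c)"
proof -
  have "transpose k (Suc k) c = c" using assms by simp
  then have "children (swap_labels k p) c = transpose k (Suc k) -` children p c"
    by (auto simp: children_def swap_labels_Some_iff)
  then show ?thesis
    by (simp add: card_vimage_inj surj_transpose)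
qed

text \<open>Before the exchange the parent of \<open>k\<close> is below \<open>k\<close> and that of
  \<open>k + 1\<close> is above \<open>k + 1\<close>; afterwards these parents are interchanged, so
  \<open>(k, k + 1)\<close> becomes a counted pair. All other pairs correspond under the
  transposition.\<close>

lemma yy_swap_labels:
  assumes p: "p \<in> trees_of_word (u @ [False, True] @ v)" and k: "k = Suc (length u)"
    and q: "nested_map n (swap_labels k p)" and n: "n = length (u @ [False, True] @ v)"
  shows "yy n (swap_labels k p) = Suc (yy n p)"
proof -
  let ?s = "transpose k (Suc k)" and ?q = "swap_labels k p"
  let ?Y = "\<lambda>p. {(i, j). i < j \<and> j \<le> n \<and>
    (\<exists>x y. p i = Some x \<and> p j = Some y \<and> y < i \<and> j < (x::nat))}"
  have nm: "nested_map n p" using trees_of_word_nested[OF p] n by simp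
  have kn: "1 \<le> k" "Suc k \<le> n" using k n by auto
  have pk: "h < k" if "p k = Some h" for h
    using trees_of_word_less_iff[OF p that] nested_map_SomeD(4)[OF nm that] kn(2)
    by (simp add: k n nth_append)
  have pSk: "Suc k < h" if "p (Suc k) = Some h" for h
    using trees_of_word_less_iff[OF p that] kn(2) by (simp add: k n nth_append)
  obtain h h' where hk: "p k = Some h" and hSk: "p (Suc k) = Some h'"
    using nested_map_Some[OF nm, of k] nested_map_Some[OF nm, of "Suc k"] kn by auto
  \<comment> \<open>Children of a vertex lie on the same side of it as its parent.\<close>
  have ck: "i < k" if "p i = Some k" for i
    using trees_of_word_betweenD[OF p that hk] pk[OF hk] by (auto simp: strictly_between_def)
  have cSk: "Suc k < i" if "p i = Some (Suc k)" for i
    using trees_of_word_betweenD[OF p that hSk] pSk[OF hSk] by (auto simp: strictly_between_def)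
  \<comment> \<open>The excluded pair is the one that the transposition sends to the new pair
    \<open>(k, Suc k)\<close>.\<close>
  have key: "(?s i, ?s j) \<in> ?Y ?q \<longleftrightarrow> (i, j) \<in> ?Y p" if ij: "(i, j) \<noteq> (Suc k, k)" for i j
  proof (cases "(i, j) = (k, Suc k)")
    case True
    then show ?thesis using pk[OF hk] hk by auto
  next
    case False
    then have na: "\<not> adjacent k i j" using ij by (auto simp: adjacent_def)
    have le: "?s j \<le> n \<longleftrightarrow> j \<le> n" using kn by (auto simp: transpose_def)
    have "?s i < ?s j \<and> ?s y < ?s i \<and> ?s j < ?s x \<longleftrightarrow> i < j \<and> y < i \<and> j < x"
      if i: "p i = Some x" and j: "p j = Some y" for x y
    proof -
      \<comment> \<open>In the first four cases a comparison is reversed, but the positions of the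
        parents and children of \<open>k\<close> and \<open>Suc k\<close> make both sides false. In
        the last case every comparison is preserved.\<close>
      consider "y = k" "i = Suc k" | "y = Suc k" "i = k" | "x = Suc k" "j = k" | "x = k" "j = Suc k"
        | "\<not> adjacent k y i" "\<not> adjacent k j x"
        by (auto simp: adjacent_def)
      then show ?thesis
      proof cases
        case 1
        then have "j < k" using ck j by simp
        then show ?thesis using 1 by (simp add: transpose_def)
      next
        case 2
        then have "x < k" using pk i by simp
        then show ?thesis using 2 by (simp add: transpose_def)
      next
        case 3
        then have "Suc k < i" using cSk i by simp
        then show ?thesis using 3 by (simp add: transpose_def)
      next
        case 4
        then have "Suc k < y" using pSk j by simp
        then show ?thesis using 4 by (simp add: transpose_def)
      next
        case 5
        then show ?thesis using na by (simp add: transpose_less_iff)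
      qed
    qed
    then show ?thesis using le by (auto; blast)
  qed
  have "(i, j) \<in> ?Y ?q \<longleftrightarrow> (i, j) \<in> insert (k, Suc k) (map_prod ?s ?s ` ?Y p)" for i j
  proof (cases "(i, j) = (k, Suc k)")
    case True
    have "?q k = Some h'" "?q (Suc k) = Some h"
      using hk hSk pk[OF hk] pSk[OF hSk] by (simp_all add: swap_labels_Some_iff)
    then show ?thesis using True pk[OF hk] pSk[OF hSk] kn by auto
  next
    case False
    then have ne: "(?s i, ?s j) \<noteq> (Suc k, k)"
      by (metis prod.inject transpose_apply_second transpose_apply_first transpose_involutory)
    have "(i, j) \<in> map_prod ?s ?s ` ?Y p \<longleftrightarrow> (?s i, ?s j) \<in> ?Y p"
      by (force simp: image_iff)
    moreover have "(i, j) \<in> ?Y ?q \<longleftrightarrow> (?s i, ?s j) \<in> ?Y p"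
      using key[OF ne] by (simp only: transpose_involutory)
    ultimately show ?thesis by (simp only: insert_iff False simp_thms)
  qed
  then have "?Y ?q = insert (k, Suc k) (map_prod ?s ?s ` ?Y p)" by auto
  moreover have "finite (?Y p)"
    by (rule finite_subset[of _ "{..n} \<times> {..n}"]) auto
  moreover have "(k, Suc k) \<notin> map_prod ?s ?s ` ?Y p"
    by (auto simp: transpose_def split: if_splits)
  moreover have "inj_on (map_prod ?s ?s) (?Y p)"
    by (auto simp: inj_on_def dest: transpose_eq_imp_eq)
  ultimately show ?thesis
    unfolding yy_eq[OF nm] yy_eq[OF q] by (simp add: card_image)
qed

lemma sum_tree_weight_separated:
  assumes k: "k = Suc (length u)"
  shows "(\<Sum>q | q \<in> trees_of_word (u @ [True, False] @ v) \<and> q k \<noteq> Some (Suc k) \<and> q (Suc k) \<noteq> Some k.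
      tree_weight (length (u @ [True, False] @ v)) q) = var_q * bracket (u @ [False, True] @ v)"
proof -
  let ?w1 = "u @ [False, True] @ v" and ?w2 = "u @ [True, False] @ v"
  let ?Q = "{q. q \<in> trees_of_word ?w2 \<and> q k \<noteq> Some (Suc k) \<and> q (Suc k) \<noteq> Some k}"
  \<comment> \<open>For 01 an edge between the two vertices is already impossible: letter 0 at
    \<open>k\<close> forces a smaller parent and letter 1 at \<open>k + 1\<close> a larger
    one.\<close>
  have sep1: "separated k p" if "p \<in> trees_of_word ?w1" for p
  proof (rule trees_of_word_separated[OF that k])
    show "p k \<noteq> Some (Suc k)" "p (Suc k) \<noteq> Some k"
      using trees_of_word_less_iff[OF that, of k "Suc k"] trees_of_word_less_iff[OF that, of "Suc k" k]
      by (auto simp: k nth_append)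
  qed simp
  have sep2: "separated k q" if "q \<in> ?Q" for q
    by (rule trees_of_word_separated[of q u True False v, OF _ k]) (use that in simp_all)
  have to_Q: "swap_labels k p \<in> ?Q" if "p \<in> trees_of_word ?w1" for p
    using swap_labels_in_trees_of_word[OF that k sep1[OF that]]
      separated_swap_labels[OF sep1[OF that]] by (auto simp: separated_def adjacent_def)
  have "bij_betw (swap_labels k) (trees_of_word ?w1) ?Q"
    by (rule bij_betw_byWitness[where f' = "swap_labels k"])
      (use to_Q swap_labels_in_trees_of_word[OF _ k sep2] in auto)
  moreover have "tree_weight (length ?w2) (swap_labels k p) = var_q * tree_weight (length ?w1) p"
    if p: "p \<in> trees_of_word ?w1" for p
  proof -
    have "nested_map (length ?w1) (swap_labels k p)"
      using to_Q[OF p] trees_of_word_nested by fastforce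
    then show ?thesis
      using yy_swap_labels[OF p k _ refl] card_children_swap_labels[of 0 k p]
        card_children_swap_labels[of "length ?w1 + 1" k p] k
      by (simp add: tree_weight_def mult.assoc mult.left_commute)
  qed
  ultimately show ?thesis
    unfolding bracket_eq sum_distrib_left
    by (simp only: sum.reindex_bij_betw[symmetric] cong: sum.cong)
qed

section \<open>The three identities\<close>

lemma bracket_True_False:
  "bracket (u @ [True, False] @ v) =
    var_q * bracket (u @ [False, True] @ v) + bracket (u @ [True] @ v) + bracket (u @ [False] @ v)"
proof -
  let ?w = "u @ [True, False] @ v" and ?k = "Suc (length u)"
  let ?T = "trees_of_word ?w" and ?f = "tree_weight (length (u @ [True, False] @ v))"
  let ?A = "{q. q \<in> ?T \<and> q ?k \<noteq> Some (Suc ?k) \<and> q (Suc ?k) \<noteq> Some ?k}"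
  let ?B = "{q. q \<in> ?T \<and> q (Suc ?k) = Some ?k}"
  let ?C = "{q. q \<in> ?T \<and> q ?k = Some (Suc ?k)}"
  have "False" if "q \<in> ?T" "q ?k = Some (Suc ?k)" "q (Suc ?k) = Some ?k" for q
    using trees_of_word_betweenD[OF that] by (simp add: strictly_between_def)
  then have "?A \<inter> ?B = {}" "(?A \<union> ?B) \<inter> ?C = {}" by blast+
  moreover have "?T = ?A \<union> ?B \<union> ?C" by blast
  moreover have "finite ?A" "finite ?B" "finite ?C" using finite_trees_of_word[of ?w] by simp_all
  ultimately have "sum ?f ?T = sum ?f ?A + sum ?f ?B + sum ?f ?C"
    by (metis (no_types, lifting) finite_UnI sum.union_disjoint)
  moreover have "sum ?f ?A = var_q * bracket (u @ [False, True] @ v)"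
    by (rule sum_tree_weight_separated) simp
  \<comment> \<open>The deleted leaf is \<open>k + 1\<close> with letter 0, so the prefix to its
    left is \<open>u @ [True]\<close>; being nonempty, it contributes no \<open>var_a\<close>. In
    the next sum the suffix \<open>False # v\<close> likewise contributes no
    \<open>var_b\<close>.\<close>
  moreover have "sum ?f ?B = bracket (u @ [True] @ v)"
    using sum_tree_weight_parent_pred[of "u @ [True]" v] by simp
  moreover have "sum ?f ?C = bracket (u @ [False] @ v)"
    using sum_tree_weight_parent_Suc[of ?k u "False # v"] by simp
  ultimately show ?thesis unfolding bracket_eq[of ?w] by simp
qed

lemma bracket_False_Cons: "bracket (False # v) = var_a * bracket v"
proof -
  have "p 1 = Some 0" if p: "p \<in> trees_of_word (False # v)" for p
  proof -
    obtain j where j: "p 1 = Some j"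
      using nested_map_Some[OF trees_of_word_nested[OF p], of 1] by auto
    then have "\<not> 1 < j" "j \<noteq> 1"
      using trees_of_word_less_iff[OF p j] nested_map_SomeD(4)[OF trees_of_word_nested[OF p] j]
      by auto
    then show ?thesis using j by simp
  qed
  then have "{q. q \<in> trees_of_word (False # v) \<and> q 1 = Some 0} = trees_of_word (False # v)"
    by blast
  then show ?thesis
    using sum_tree_weight_parent_pred[of "[]" v] by (simp add: bracket_eq[of "False # v"])
qed

lemma bracket_append_True: "bracket (u @ [True]) = var_b * bracket u"
proof -
  let ?k = "Suc (length u)"
  have "p ?k = Some (Suc ?k)" if p: "p \<in> trees_of_word (u @ [True])" for p
  proof -
    obtain j where j: "p ?k = Some j"
      using nested_map_Some[OF trees_of_word_nested[OF p], of ?k] by auto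
    then have "?k < j" "j \<le> Suc ?k"
      using trees_of_word_less_iff[OF p j] nested_map_SomeD(3)[OF trees_of_word_nested[OF p] j]
      by auto
    then show ?thesis using j by simp
  qed
  then have "{q. q \<in> trees_of_word (u @ [True]) \<and> q ?k = Some (Suc ?k)} = trees_of_word (u @ [True])"
    by blast
  then show ?thesis
    using sum_tree_weight_parent_Suc[of ?k u "[]"] by (simp add: bracket_eq[of "u @ [True]"])
qed

theorem theorem3p3:
  fixes u v :: "bool list"
  shows "(bracket (u @ [True, False] @ v) =
           var_q * bracket (u @ [False, True] @ v) + bracket (u @ [True] @ v) + bracket (u @ [False] @ v))
         \<and> bracket ([False] @ v) = var_a * bracket v
         \<and> bracket (u @ [True]) = var_b * bracket u"
  using bracket_True_False bracket_False_Cons bracket_append_True by simp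

end
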